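(* Let $X, Y_1,\dots,Y_m$ be real linear topological spaces, let $F:X\to\mathbb{R}$ be a mapping, let $G_j:X\to Y_j$ ($j=1,\dots,m$) be continuous mappings, and let $K_j\subset Y_j$ ($j=1,\dots,m$) be convex cones. Let $\bar K$ be the closure in $\mathbb{R}\times Y_1\times\dots\times Y_m$ of the cone $K$ generated by the set $\{(F(x),G_1(x),\dots,G_m(x)) : x\in X\}$. Suppose that $\bar K$ is convex. Then the S-procedure with conic constraints is lossless, i.e. the condition (A) $F(x)\ge 0$ for every $x\in X$ such that $G_j(x)\in K_j$ for all $j=1,\dots,m$ implies the condition (B) there exist $\tau_0\ge 0$ and $\tau_j\in K_j^*$ ($j=1,\dots,m$) such that $\tau_0F(x)-\sum_{j=1}^m\langle\tau_j,G_j(x)\rangle\ge 0$ for all $x\in X$. If, in addition, the constraints are regular, namely there exists $x_0\in X$ such that $G_j(x_0)\in\operatorname{Int}K_j$ for all $j=1,\dots,m$, then one can choose $\tau_0=1$ in (B); that is, (A) implies that (B) holds with $\tau_0=1$.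
   Context: $Y_j^*$ denotes the space of continuous linear functionals on $Y_j$, and $\langle y^*,y\rangle$ denotes the value of $y^*\in Y_j^*$ at $y\in Y_j$. The dual cone is $K_j^*=\{y^*\in Y_j^*:\langle y^*,y\rangle\ge 0\ \ \forall y\in K_j\}$. $\operatorname{Int}$ denotes the topological interior. The product $\mathbb{R}\times Y_1\times\dots\times Y_m$ carries the product topology. The cone generated by a set $S$ is the set of all positive multiples $\lambda s$, $\lambda>0$, $s\in S$ (no convex hull is taken). *)

theory Defs
  imports "HOL-Analysis.Analysis"
begin

text \<open>
  A real linear topological space is given by a topology whose underlying set is a linear
  subspace of an ambient real vector space, and for which addition and scalar multiplication are
  jointly continuous. The ambient type carries no topology. Taking subspaces with their own
  topologies, rather than whole types, lets a family \<open>Y 1, ..., Y m\<close> indexed by a natural number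
  consist of unrelated spaces: any such family embeds linearly in one vector space, for instance
  the direct sum of its members. No separation axiom is imposed.
\<close>

definition linear_topological_space :: "'a::real_vector topology \<Rightarrow> bool" where
  "linear_topological_space T \<longleftrightarrow>
     subspace (topspace T) \<and>
     continuous_map (prod_topology T T) T (\<lambda>(x, y). x + y) \<and>
     continuous_map (prod_topology euclideanreal T) T (\<lambda>(c, x). c *\<^sub>R x)"

text \<open>
  Functionals are total functions on the ambient type; only their values on \<open>topspace T\<close>
  are constrained.
\<close>

definition continuous_dual :: "'a::real_vector topology \<Rightarrow> ('a \<Rightarrow> real) set" where
  "continuous_dual T =
     {f. (\<forall>x\<in>topspace T. \<forall>y\<in>topspace T. f (x + y) = f x + f y) \<and>
         (\<forall>c. \<forall>x\<in>topspace T. f (c *\<^sub>R x) = c * f x) \<and>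
         continuous_map T euclideanreal f}"

definition dual_cone :: "'a::real_vector topology \<Rightarrow> 'a set \<Rightarrow> ('a \<Rightarrow> real) set" where
  "dual_cone T K = {f \<in> continuous_dual T. \<forall>y\<in>K. f y \<ge> 0}"

text \<open>
  Cones are closed under multiplication by positive scalars and need not contain the origin.
  The predicate \<^const>\<open>convex_cone\<close> of the library also requires the origin to be a member,
  so it would be more restrictive.
\<close>

definition pos_convex_cone :: "'a::real_vector set \<Rightarrow> bool" where
  "pos_convex_cone K \<longleftrightarrow> convex K \<and> (\<forall>x\<in>K. \<forall>c>0. c *\<^sub>R x \<in> K)"

text \<open>
  Points of the product of the real line with \<open>Y 1, ..., Y m\<close> are pairs of a real number and
  an extensional function on \<open>{1..m}\<close>. The linear operations restrict their result to
  \<open>{1..m}\<close> so that it is again extensional.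
\<close>

definition real_prod_topology ::
    "nat \<Rightarrow> (nat \<Rightarrow> 'a::real_vector topology) \<Rightarrow> (real \<times> (nat \<Rightarrow> 'a)) topology" where
  "real_prod_topology m Y = prod_topology euclideanreal (product_topology Y {1..m})"

definition real_prod_add ::
    "nat \<Rightarrow> real \<times> (nat \<Rightarrow> 'a::real_vector) \<Rightarrow> real \<times> (nat \<Rightarrow> 'a) \<Rightarrow> real \<times> (nat \<Rightarrow> 'a)" where
  "real_prod_add m p q = (fst p + fst q, \<lambda>j\<in>{1..m}. snd p j + snd q j)"

definition real_prod_scale ::
    "nat \<Rightarrow> real \<Rightarrow> real \<times> (nat \<Rightarrow> 'a::real_vector) \<Rightarrow> real \<times> (nat \<Rightarrow> 'a)" where
  "real_prod_scale m c p = (c * fst p, \<lambda>j\<in>{1..m}. c *\<^sub>R snd p j)"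

definition real_prod_convex :: "nat \<Rightarrow> (real \<times> (nat \<Rightarrow> 'a::real_vector)) set \<Rightarrow> bool" where
  "real_prod_convex m C \<longleftrightarrow>
     (\<forall>p\<in>C. \<forall>q\<in>C. \<forall>u\<ge>0. \<forall>v\<ge>0. u + v = 1 \<longrightarrow>
        real_prod_add m (real_prod_scale m u p) (real_prod_scale m v q) \<in> C)"

definition generated_cone ::
    "nat \<Rightarrow> (real \<times> (nat \<Rightarrow> 'a::real_vector)) set \<Rightarrow> (real \<times> (nat \<Rightarrow> 'a)) set" where
  "generated_cone m S = {real_prod_scale m c s | c s. c > 0 \<and> s \<in> S}"

definition joint_image ::
    "nat \<Rightarrow> 'x topology \<Rightarrow> ('x \<Rightarrow> real) \<Rightarrow> (nat \<Rightarrow> 'x \<Rightarrow> 'a) \<Rightarrow> (real \<times> (nat \<Rightarrow> 'a)) set" where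
  "joint_image m X F G = (\<lambda>x. (F x, \<lambda>j\<in>{1..m}. G j x)) ` topspace X"

end

theory Submission
  imports Defs "HOL-Library.Function_Algebras"
begin

text \<open>
  The regular case is a separation argument in the product of the real line with
  \<open>Y 1, ..., Y m\<close>. Let \<open>C\<close> be the closed convex set of the hypothesis and let
  \<open>D\<close> be the set of all \<open>(a, y)\<close> with \<open>a < 0\<close> and every \<open>y j\<close> interior to
  \<open>K j\<close>. Condition (A) says that no point of the generated cone lies in \<open>D\<close>; since
  \<open>D\<close> is open, it does not meet \<open>C\<close> either. A linear functional
  \<open>(a, y) \<mapsto> \<tau>\<^sub>0 a - (\<tau> 1 (y 1) + ... + \<tau> m (y m))\<close> that is nonnegative on \<open>C\<close>
  and negative on \<open>D\<close> has \<open>\<tau>\<^sub>0 \<ge> 0\<close> and \<open>\<tau> j \<ge> 0\<close> on \<open>K j\<close>. With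
  \<open>w = (G 1 x\<^sub>0, ..., G m x\<^sub>0)\<close> at the regular point, normalise its value at
  \<open>(-1, w) \<in> D\<close> to \<open>-1\<close>, that is, \<open>\<tau>\<^sub>0 + (\<tau> 1 (w 1) + ... + \<tau> m (w m)) = 1\<close>.
  If \<open>\<tau>\<^sub>0\<close> were zero, the functional would be \<open>-1\<close> at \<open>(F x\<^sub>0, w) \<in> C\<close>. Hence
  \<open>\<tau>\<^sub>0 > 0\<close>, and one divides by it.

  The separation itself is algebraic. It is enough to find a linear functional that is
  nonnegative on the convex cone \<open>P\<close> generated by \<open>C\<close> and by all \<open>(a, - y)\<close> with
  \<open>a \<ge> 0\<close> and each \<open>y j\<close> in \<open>K j\<close> or zero, and that equals \<open>1\<close> at
  \<open>e = (1, - w)\<close>. Interiority of \<open>w\<close> makes \<open>e\<close> an order unit for \<open>P\<close>, and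
  disjointness of \<open>C\<close> and \<open>D\<close> gives \<open>- e \<notin> P\<close>. Zorn's lemma enlarges \<open>P\<close> to a
  cone of a total preorder (\<open>convex_cone_extend_total\<close>), and a total preorder with an order
  unit has a unique normalised positive functional, given by Dedekind cuts
  (\<open>total_convex_cone_functional\<close>). Topology enters at the end: a linear functional that is
  nonnegative on a nonempty open set is continuous
  (\<open>nonneg_on_open_imp_continuous\<close>), so the components \<open>\<tau> j\<close> belong to the dual cones.
  These steps are assembled in \<open>conic_multipliers\<close>.

  The condition (B) without normalisation of \<open>\<tau>\<^sub>0\<close> allows all multipliers to vanish, and
  zero multipliers witness the first implication.
\<close>

section \<open>Positive functionals on ordered vector spaces\<close>

text \<open>Pointwise scaling, so that the product with the real line is a real vector space.\<close>

instantiation "fun" :: (type, real_vector) real_vector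
begin

definition scaleR_fun :: "real \<Rightarrow> ('a \<Rightarrow> 'b) \<Rightarrow> 'a \<Rightarrow> 'b" where
  "scaleR_fun c f = (\<lambda>x. c *\<^sub>R f x)"

instance
  by standard (auto simp: scaleR_fun_def fun_eq_iff scaleR_add_right scaleR_add_left)

end

lemma scaleR_fun_apply [simp]: "(c *\<^sub>R f) x = c *\<^sub>R f x"
  by (simp add: scaleR_fun_def)

text \<open>
  Take a maximal convex cone in \<open>S\<close> avoiding \<open>- e\<close>. If it does not contain \<open>- v\<close>, then
  adjoining \<open>v\<close> still avoids \<open>- e\<close>: an equation \<open>- e = q + c v\<close> would make
  \<open>- v\<close> a positive multiple of \<open>q + e\<close>. By maximality \<open>v\<close> already belongs to the cone.
\<close>

lemma convex_cone_extend_total: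
  fixes S P :: "'a::real_vector set"
  assumes S: "subspace S" and P: "convex_cone P" "P \<subseteq> S" "e \<in> P" "- e \<notin> P"
  obtains Q where "convex_cone Q" "P \<subseteq> Q" "Q \<subseteq> S" "- e \<notin> Q"
    and "\<And>v. v \<in> S \<Longrightarrow> v \<in> Q \<or> - v \<in> Q"
proof -
  define A where "A = {Q. convex_cone Q \<and> P \<subseteq> Q \<and> Q \<subseteq> S \<and> - e \<notin> Q}"
  have "\<exists>Q\<in>A. \<forall>X\<in>A. Q \<subseteq> X \<longrightarrow> X = Q"
  proof (rule subset_Zorn_nonempty)
    show "A \<noteq> {}" using P by (auto simp: A_def)
  next
    fix \<C> assume ne: "\<C> \<noteq> {}" and ch: "subset.chain A \<C>"
    have sub: "\<C> \<subseteq> A" and tot: "\<And>X Y. X \<in> \<C> \<Longrightarrow> Y \<in> \<C> \<Longrightarrow> X \<subseteq> Y \<or> Y \<subseteq> X"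
      using ch by (auto simp: subset_chain_def)
    have cone: "convex_cone U" if "U \<in> \<C>" for U
      using sub that by (auto simp: A_def)
    have "convex_cone (\<Union>\<C>)"
      unfolding convex_cone_iff
    proof (intro conjI ballI allI impI)
      show "0 \<in> \<Union>\<C>"
        using ne cone convex_cone_contains_0 by blast
      show "x + y \<in> \<Union>\<C>" if xy: "x \<in> \<Union>\<C>" "y \<in> \<Union>\<C>" for x y
      proof -
        obtain U V where UV: "x \<in> U" "U \<in> \<C>" "y \<in> V" "V \<in> \<C>" using xy by auto
        then obtain W where "W \<in> \<C>" "x \<in> W" "y \<in> W" using tot by blast
        then show ?thesis using convex_cone_add[OF cone] by blast
      qed
      show "c *\<^sub>R x \<in> \<Union>\<C>" if "x \<in> \<Union>\<C>" "0 \<le> c" for x c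
        using that convex_cone_scaleR[OF cone] by blast
    qed
    then show "\<Union>\<C> \<in> A" using ne sub by (fastforce simp: A_def)
  qed
  then obtain Q where Q: "convex_cone Q" "P \<subseteq> Q" "Q \<subseteq> S" "- e \<notin> Q"
    and max: "\<And>X. X \<in> A \<Longrightarrow> Q \<subseteq> X \<Longrightarrow> X = Q"
    by (auto simp: A_def)
  have "v \<in> Q \<or> - v \<in> Q" if v: "v \<in> S" for v
  proof (rule disjCI)
    assume nv: "- v \<notin> Q"
    define R where "R = {q + c *\<^sub>R v | q c. q \<in> Q \<and> c \<ge> 0}"
    have R: "convex_cone R"
      unfolding convex_cone_iff
    proof (intro conjI ballI allI impI)
      show "0 \<in> R" using convex_cone_contains_0[OF Q(1)] by (force simp: R_def)
      show "x + y \<in> R" if xy: "x \<in> R" "y \<in> R" for x y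
      proof -
        obtain p c q d where "x = p + c *\<^sub>R v" "y = q + d *\<^sub>R v" "p \<in> Q" "q \<in> Q" "c \<ge> 0" "d \<ge> 0"
          using xy by (auto simp: R_def)
        then have "x + y = (p + q) + (c + d) *\<^sub>R v" "p + q \<in> Q" "c + d \<ge> 0"
          using convex_cone_add[OF Q(1)] by (auto simp: algebra_simps)
        then show ?thesis unfolding R_def by blast
      qed
      show "c *\<^sub>R x \<in> R" if x: "x \<in> R" and c: "0 \<le> c" for x c
      proof -
        obtain p d where "x = p + d *\<^sub>R v" "p \<in> Q" "d \<ge> 0"
          using x unfolding R_def by blast
        then have "c *\<^sub>R x = c *\<^sub>R p + (c * d) *\<^sub>R v" "c *\<^sub>R p \<in> Q" "c * d \<ge> 0"
          using convex_cone_scaleR[OF Q(1)] c by (auto simp: algebra_simps)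
        then show ?thesis unfolding R_def by blast
      qed
    qed
    have QR: "Q \<subseteq> R" unfolding R_def by force
    have RS: "R \<subseteq> S"
      using Q(3) v S by (auto simp: R_def subspace_add subspace_scale subset_iff)
    have "0 + 1 *\<^sub>R v \<in> R"
      using convex_cone_contains_0[OF Q(1)] zero_le_one unfolding R_def by blast
    then have vR: "v \<in> R" by simp
    have "- e \<notin> R"
    proof
      assume "- e \<in> R"
      then obtain q c where q: "- e = q + c *\<^sub>R v" "q \<in> Q" "c \<ge> 0" by (auto simp: R_def)
      then have "c \<noteq> 0" using Q(4) by auto
      have "c *\<^sub>R v = - e - q" unfolding q(1) by simp
      then have "c *\<^sub>R (- v) = q + e" by simp
      then have "(1 / c) *\<^sub>R (q + e) = (1 / c) *\<^sub>R c *\<^sub>R (- v)" by (simp only:)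
      then have "- v = (1 / c) *\<^sub>R (q + e)" using \<open>c \<noteq> 0\<close> by simp
      moreover have "(1 / c) *\<^sub>R (q + e) \<in> Q"
        using q Q(2) P(3) by (intro convex_cone_scaleR[OF Q(1)] convex_cone_add[OF Q(1)]) auto
      ultimately show False using nv by simp
    qed
    then have "R \<in> A" using R QR RS Q(2) by (auto simp: A_def)
    then show "v \<in> Q" using max QR vR by blast
  qed
  then show thesis using that Q by blast
qed

text \<open>
  Read \<open>Q\<close> as the set of nonnegative elements of a total preorder. The functional sends
  \<open>v\<close> to the cut that \<open>v\<close> makes in the multiples of \<open>e\<close>. Cuts exist because \<open>e\<close> is an
  order unit, are bounded because \<open>- e\<close> is not nonnegative, and are additive because the
  preorder is total.
\<close>

lemma total_convex_cone_functional:
  fixes S Q :: "'a::real_vector set"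
  assumes S: "subspace S" and Q: "convex_cone Q" "e \<in> Q" "- e \<notin> Q" "e \<in> S"
    and tot: "\<And>v. v \<in> S \<Longrightarrow> v \<in> Q \<or> - v \<in> Q"
    and unit: "\<And>v. v \<in> S \<Longrightarrow> \<exists>t. v + t *\<^sub>R e \<in> Q"
  obtains f :: "'a \<Rightarrow> real" where "\<And>v w. v \<in> S \<Longrightarrow> w \<in> S \<Longrightarrow> f (v + w) = f v + f w"
    and "\<And>c v. v \<in> S \<Longrightarrow> f (c *\<^sub>R v) = c * f v"
    and "\<And>v. v \<in> S \<Longrightarrow> v \<in> Q \<Longrightarrow> f v \<ge> 0" and "f e = 1"
proof -
  define f where "f v = Sup {t. v - t *\<^sub>R e \<in> Q}" for v
  have nonneg: "t \<ge> 0" if "t *\<^sub>R e \<in> Q" for t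
  proof (rule ccontr)
    assume "\<not> t \<ge> 0"
    then have "inverse (- t) *\<^sub>R t *\<^sub>R e \<in> Q"
      using convex_cone_scaleR[OF Q(1) _ that, of "inverse (- t)"] by simp
    then show False using \<open>\<not> t \<ge> 0\<close> Q(3) by simp
  qed
  have le: "s \<le> t" if "v - s *\<^sub>R e \<in> Q" "t *\<^sub>R e - v \<in> Q" for s t v
    using nonneg[of "t - s"] convex_cone_add[OF Q(1) that] by (simp add: algebra_simps)
  have upper: "f v \<le> b" if v: "v \<in> S" and "b *\<^sub>R e - v \<in> Q" for v b
  proof -
    obtain t where "v + t *\<^sub>R e \<in> Q" using unit v by blast
    then have "- t \<in> {t. v - t *\<^sub>R e \<in> Q}" by simp
    then have "{t. v - t *\<^sub>R e \<in> Q} \<noteq> {}" by blast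
    then show ?thesis unfolding f_def using le that by (intro cSup_least) auto
  qed
  have lower: "a \<le> f v" if v: "v \<in> S" and a: "v - a *\<^sub>R e \<in> Q" for v a
  proof -
    obtain t where "- v + t *\<^sub>R e \<in> Q" using unit v S subspace_neg by blast
    then have "t *\<^sub>R e - v \<in> Q" by simp
    then have "s \<le> t" if "s \<in> {t. v - t *\<^sub>R e \<in> Q}" for s using le that by blast
    then have "bdd_above {t. v - t *\<^sub>R e \<in> Q}" by (rule bdd_aboveI)
    then show ?thesis unfolding f_def using a by (intro cSup_upper) auto
  qed
  have in_S: "v - a *\<^sub>R e \<in> S" if "v \<in> S" for v a
    using that S Q(4) by (simp add: subspace_diff subspace_scale)
  have below: "v - a *\<^sub>R e \<in> Q" if "v \<in> S" "a < f v" for v a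
    using tot[OF in_S] upper[of v a] that by force
  have above: "b *\<^sub>R e - v \<in> Q" if "v \<in> S" "f v < b" for v b
    using tot[OF in_S, of v b] lower[of v b] that by force
  have add: "f (v + w) = f v + f w" if v: "v \<in> S" and w: "w \<in> S" for v w
  proof (rule antisym; rule field_le_epsilon)
    fix \<epsilon> :: real assume "\<epsilon> > 0"
    have vw: "v + w \<in> S" using v w S by (simp add: subspace_add)
    have "((f v + \<epsilon>/2) *\<^sub>R e - v) + ((f w + \<epsilon>/2) *\<^sub>R e - w) \<in> Q"
      using above v w \<open>\<epsilon> > 0\<close> by (intro convex_cone_add[OF Q(1)]) auto
    moreover have "((f v + \<epsilon>/2) *\<^sub>R e - v) + ((f w + \<epsilon>/2) *\<^sub>R e - w)
        = (f v + f w + \<epsilon>) *\<^sub>R e - (v + w)"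
      by (simp add: algebra_simps flip: scaleR_add_left)
    ultimately show "f (v + w) \<le> f v + f w + \<epsilon>" using upper[OF vw] by simp
    have "(v - (f v - \<epsilon>/2) *\<^sub>R e) + (w - (f w - \<epsilon>/2) *\<^sub>R e) \<in> Q"
      using below v w \<open>\<epsilon> > 0\<close> by (intro convex_cone_add[OF Q(1)]) auto
    moreover have "(v - (f v - \<epsilon>/2) *\<^sub>R e) + (w - (f w - \<epsilon>/2) *\<^sub>R e)
        = (v + w) - (f v + f w - \<epsilon>) *\<^sub>R e"
      by (simp add: algebra_simps flip: scaleR_add_left)
    ultimately show "f v + f w \<le> f (v + w) + \<epsilon>" using lower[OF vw, of "f v + f w - \<epsilon>"] by simp
  qed
  have zero: "f 0 = 0"
    using add[of 0 0] S by (simp add: subspace_0)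
  have pos: "f (c *\<^sub>R v) = c * f v" if v: "v \<in> S" and c: "c > 0" for c v
  proof (rule antisym; rule field_le_epsilon)
    fix \<epsilon> :: real assume "\<epsilon> > 0"
    have cv: "c *\<^sub>R v \<in> S" using v S by (simp add: subspace_scale)
    have "c *\<^sub>R ((f v + \<epsilon>/c) *\<^sub>R e - v) \<in> Q"
      using above v c \<open>\<epsilon> > 0\<close> by (intro convex_cone_scaleR[OF Q(1)]) auto
    moreover have "c *\<^sub>R ((f v + \<epsilon>/c) *\<^sub>R e - v) = (c * f v + \<epsilon>) *\<^sub>R e - c *\<^sub>R v"
      using c by (simp add: algebra_simps)
    ultimately show "f (c *\<^sub>R v) \<le> c * f v + \<epsilon>" using upper[OF cv] by simp
    have "c *\<^sub>R (v - (f v - \<epsilon>/c) *\<^sub>R e) \<in> Q"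
      using below v c \<open>\<epsilon> > 0\<close> by (intro convex_cone_scaleR[OF Q(1)]) auto
    moreover have "c *\<^sub>R (v - (f v - \<epsilon>/c) *\<^sub>R e) = c *\<^sub>R v - (c * f v - \<epsilon>) *\<^sub>R e"
      using c by (simp add: algebra_simps)
    ultimately show "c * f v \<le> f (c *\<^sub>R v) + \<epsilon>" using lower[OF cv, of "c * f v - \<epsilon>"] by simp
  qed
  have neg: "f (- v) = - f v" if "v \<in> S" for v
    using add[of v "- v"] zero that S by (simp add: subspace_neg)
  show thesis
  proof
    show "f (v + w) = f v + f w" if "v \<in> S" "w \<in> S" for v w using add that .
    show "f (c *\<^sub>R v) = c * f v" if v: "v \<in> S" for c v
    proof (cases c "0::real" rule: linorder_cases)
      case less
      then show ?thesis using pos[of "- v" "- c"] neg v S by (simp add: subspace_neg)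
    qed (use pos v zero in auto)
    show "f v \<ge> 0" if "v \<in> S" "v \<in> Q" for v using lower[of v 0] that by simp
    show "f e = 1"
      using lower[of e 1] upper[of e 1] Q convex_cone_contains_0[OF Q(1)] by simp
  qed
qed

section \<open>Open sets and cones in linear topological spaces\<close>

lemma affine_preimage_open:
  assumes T: "linear_topological_space T" and U: "openin T U" and a: "a \<in> topspace T"
  shows "openin T {w \<in> topspace T. r *\<^sub>R w + a \<in> U}"
proof -
  have "continuous_map T T ((\<lambda>(c, x). c *\<^sub>R x) \<circ> (\<lambda>w. (r, w)))"
    using T unfolding linear_topological_space_def
    by (intro continuous_map_compose[of _ "prod_topology euclideanreal T"])
      (auto simp: continuous_map_pairwise o_def)
  then have "continuous_map T T ((\<lambda>(x, y). x + y) \<circ> (\<lambda>w. (r *\<^sub>R w, a)))"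
    using T a unfolding linear_topological_space_def
    by (intro continuous_map_compose[of _ "prod_topology T T"])
      (auto simp: continuous_map_pairwise o_def)
  then show ?thesis using openin_continuous_map_preimage[OF _ U] by (force simp: o_def)
qed

lemma open_line_preimage:
  assumes T: "linear_topological_space T" and U: "openin T U"
    and a: "a \<in> topspace T" and v: "v \<in> topspace T"
  shows "open {s. s *\<^sub>R v + a \<in> U}"
proof -
  have "continuous_map euclideanreal T ((\<lambda>(c, x). c *\<^sub>R x) \<circ> (\<lambda>s. (s, v)))"
    using T v unfolding linear_topological_space_def
    by (intro continuous_map_compose[of _ "prod_topology euclideanreal T"])
      (auto simp: continuous_map_pairwise o_def)
  then have "continuous_map euclideanreal T ((\<lambda>(x, y). x + y) \<circ> (\<lambda>s. (s *\<^sub>R v, a)))"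
    using T a unfolding linear_topological_space_def
    by (intro continuous_map_compose[of _ "prod_topology T T"])
      (auto simp: continuous_map_pairwise o_def)
  then show ?thesis
    using openin_continuous_map_preimage[OF _ U] by (force simp: o_def simp flip: open_openin)
qed

text \<open>
  Near \<open>x\<close>, both \<open>y + N (w - x)\<close> and \<open>y - N (w - x)\<close> stay in \<open>U\<close>. Nonnegativity there
  bounds \<open>N \<bar>f w - f x\<bar>\<close> by \<open>f y\<close>, and \<open>N\<close> is arbitrary.
\<close>

lemma nonneg_on_open_imp_continuous:
  fixes f :: "'a::real_vector \<Rightarrow> real"
  assumes T: "linear_topological_space T"
    and add: "\<And>v w. v \<in> topspace T \<Longrightarrow> w \<in> topspace T \<Longrightarrow> f (v + w) = f v + f w"
    and scale: "\<And>c v. v \<in> topspace T \<Longrightarrow> f (c *\<^sub>R v) = c * f v"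
    and U: "openin T U" and y: "y \<in> U" and nonneg: "\<And>u. u \<in> U \<Longrightarrow> f u \<ge> 0"
  shows "continuous_map T euclideanreal f"
proof -
  have S: "subspace (topspace T)" using T by (simp add: linear_topological_space_def)
  have yT: "y \<in> topspace T" using U y openin_subset by blast
  have "openin T {x \<in> topspace T. f x \<in> V}" if V: "open V" for V
    unfolding openin_subopen[of T "{x \<in> topspace T. f x \<in> V}"]
  proof (intro ballI)
    fix x assume "x \<in> {x \<in> topspace T. f x \<in> V}"
    then have x: "x \<in> topspace T" "f x \<in> V" by auto
    obtain \<epsilon> where \<epsilon>: "\<epsilon> > 0" "ball (f x) \<epsilon> \<subseteq> V"
      using V x(2) open_contains_ball by blast
    \<comment> \<open>The summand \<open>1\<close> keeps \<open>N\<close> positive when \<open>f y = 0\<close>.\<close>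
    define N where "N = (f y + 1) / \<epsilon>"
    have N: "N > 0" "f y < N * \<epsilon>" using \<epsilon>(1) nonneg[OF y] by (auto simp: N_def field_simps)
    define W where "W = {w \<in> topspace T. N *\<^sub>R w + (y - N *\<^sub>R x) \<in> U}
      \<inter> {w \<in> topspace T. (- N) *\<^sub>R w + (y + N *\<^sub>R x) \<in> U}"
    have inT: "y - N *\<^sub>R x \<in> topspace T" "y + N *\<^sub>R x \<in> topspace T"
      using S x yT by (auto simp: subspace_add subspace_diff subspace_scale)
    have "openin T W"
      unfolding W_def using affine_preimage_open[OF T U] inT by blast
    moreover have "x \<in> W" using x y by (simp add: W_def)
    moreover have "f w \<in> V" if "w \<in> W" for w
    proof -
      have w: "w \<in> topspace T" using that by (simp add: W_def)
      have sub: "N *\<^sub>R (w - x) \<in> topspace T" "w - x \<in> topspace T"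
        using S x w by (auto simp: subspace_diff subspace_scale)
      have "y + N *\<^sub>R (w - x) \<in> U" "y + (- N) *\<^sub>R (w - x) \<in> U"
        using that by (auto simp: W_def algebra_simps)
      then have "f y + N * f (w - x) \<ge> 0" "f y + (- N) * f (w - x) \<ge> 0"
        using nonneg add[OF yT] scale sub S by (metis subspace_scale)+
      moreover have "f w = f (w - x) + f x" using add[OF sub(2) x(1)] by simp
      ultimately have "N * \<bar>f w - f x\<bar> \<le> f y" by (auto simp: abs_if)
      then have "N * \<bar>f w - f x\<bar> < N * \<epsilon>" using N by linarith
      then have "\<bar>f w - f x\<bar> < \<epsilon>" using N by simp
      then show ?thesis using \<epsilon>(2) by (auto simp: dist_real_def subset_iff)
    qed
    ultimately show "\<exists>W. openin T W \<and> x \<in> W \<and> W \<subseteq> {x \<in> topspace T. f x \<in> V}"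
      unfolding W_def by blast
  qed
  then show ?thesis by (simp add: continuous_map_def)
qed

lemma pos_convex_cone_scaleR:
  assumes "pos_convex_cone K" "c > 0" "x \<in> K"
  shows "c *\<^sub>R x \<in> K"
  using assms by (simp add: pos_convex_cone_def)

lemma pos_convex_cone_scaleR_iff:
  assumes K: "pos_convex_cone K" and c: "c > 0"
  shows "c *\<^sub>R x \<in> K \<longleftrightarrow> x \<in> K"
proof
  assume "c *\<^sub>R x \<in> K"
  from pos_convex_cone_scaleR[OF K _ this, of "inverse c"] c show "x \<in> K" by simp
qed (rule pos_convex_cone_scaleR[OF K c])

lemma pos_convex_cone_add:
  assumes K: "pos_convex_cone K" and xy: "x \<in> K" "y \<in> K"
  shows "x + y \<in> K"
proof -
  have "(1/2) *\<^sub>R x + (1/2) *\<^sub>R y \<in> K"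
    using K xy unfolding pos_convex_cone_def by (intro convexD) auto
  then have "2 *\<^sub>R ((1/2) *\<^sub>R x + (1/2) *\<^sub>R y) \<in> K"
    by (intro pos_convex_cone_scaleR[OF K]) auto
  then show ?thesis by (simp add: scaleR_add_right)
qed

lemma pos_convex_cone_insert_0:
  assumes K: "pos_convex_cone K"
  shows "convex_cone (insert 0 K)"
proof -
  have "c *\<^sub>R x \<in> insert 0 K" if "x \<in> K" "c \<ge> 0" for c x
    using K that by (cases "c = 0") (auto simp: pos_convex_cone_def)
  moreover have "x + y \<in> insert 0 K" if "x \<in> insert 0 K" "y \<in> insert 0 K" for x y
    using pos_convex_cone_add[OF K, of x y] that by auto
  ultimately show ?thesis unfolding convex_cone_iff by auto
qed

text \<open>
  Interior points stay interior after adding elements of the cone and scaling: with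
  \<open>d = r c - w\<close>, the open set of all \<open>u\<close> for which \<open>r u - d\<close> is interior contains
  \<open>c\<close> and is contained in \<open>K\<close>.
\<close>

lemma interior_absorbs_cone:
  assumes T: "linear_topological_space T" and KT: "K \<subseteq> topspace T" and K: "pos_convex_cone K"
    and r: "r > 0" and c: "c \<in> topspace T" and w: "w \<in> T interior_of K"
    and d: "r *\<^sub>R c - w \<in> insert 0 K"
  shows "c \<in> T interior_of K"
proof -
  have S: "subspace (topspace T)" using T by (simp add: linear_topological_space_def)
  define d where "d = r *\<^sub>R c - w"
  have dK: "d \<in> insert 0 K" using d by (simp add: d_def)
  then have dT: "- d \<in> topspace T" using KT S by (auto simp: subspace_0 subspace_neg)
  let ?W = "{u \<in> topspace T. r *\<^sub>R u + (- d) \<in> T interior_of K}"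
  have "openin T ?W"
    using affine_preimage_open[OF T openin_interior_of dT] .
  moreover have "?W \<subseteq> K"
  proof
    fix u assume "u \<in> ?W"
    then have u: "r *\<^sub>R u - d \<in> K" using interior_of_subset[of T K] by auto
    have "r *\<^sub>R u \<in> K"
      using dK pos_convex_cone_add[OF K u, of d] u by auto
    then show "u \<in> K" by (simp only: pos_convex_cone_scaleR_iff[OF K r])
  qed
  moreover have "c \<in> ?W" using c w by (simp add: d_def)
  ultimately show ?thesis using interior_of_maximal by blast
qed

text \<open>
  For small \<open>s > 0\<close> the point \<open>w - s z\<close> is still in \<open>K\<close>; multiply by \<open>t = 1 / s\<close>.
\<close>

lemma interior_is_order_unit:
  assumes T: "linear_topological_space T" and K: "pos_convex_cone K"
    and w: "w \<in> T interior_of K" and z: "z \<in> topspace T"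
  obtains b where "b \<ge> 0" "\<And>t. t \<ge> b \<Longrightarrow> t *\<^sub>R w - z \<in> K"
proof -
  have S: "subspace (topspace T)" using T by (simp add: linear_topological_space_def)
  have wT: "w \<in> topspace T" using w interior_of_subset_topspace[of T K] by auto
  have "open {s. s *\<^sub>R (- z) + w \<in> T interior_of K}"
    by (rule open_line_preimage[OF T openin_interior_of wT subspace_neg[OF S z]])
  moreover have "0 \<in> {s. s *\<^sub>R (- z) + w \<in> T interior_of K}" using w by simp
  ultimately obtain \<delta> where \<delta>: "\<delta> > 0"
    "ball 0 \<delta> \<subseteq> {s. s *\<^sub>R (- z) + w \<in> T interior_of K}"
    by (meson open_contains_ball)
  have "t *\<^sub>R w - z \<in> K" if t: "t \<ge> 2 / \<delta>" for t
  proof -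
    have "t > 0" using t \<delta>(1) by (meson divide_pos_pos less_le_trans zero_less_numeral)
    moreover have "2 \<le> t * \<delta>" using t \<delta>(1) by (simp add: field_simps)
    ultimately have "inverse t \<in> ball 0 \<delta>" by (simp add: field_simps)
    then have "inverse t *\<^sub>R (- z) + w \<in> K"
      using \<delta>(2) interior_of_subset[of T K] by blast
    then have "t *\<^sub>R (inverse t *\<^sub>R (- z) + w) \<in> K"
      by (rule pos_convex_cone_scaleR[OF K \<open>t > 0\<close>])
    then show ?thesis using \<open>t > 0\<close> by (simp add: scaleR_diff_right)
  qed
  then show thesis using that[of "2 / \<delta>"] \<delta>(1) by auto
qed

section \<open>Multipliers from separation in the product space\<close>

text \<open>
  The product of the real line with \<open>Y 1, ..., Y m\<close> as a linear subspace of a type. The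
  coordinates outside \<open>{1..m}\<close> are zero here, instead of undefined as in extensional functions,
  because addition and scaling of functions are pointwise.
\<close>

definition product_space :: "nat \<Rightarrow> (nat \<Rightarrow> 'y::real_vector topology) \<Rightarrow> (real \<times> (nat \<Rightarrow> 'y)) set"
  where "product_space m Y =
    {p. (\<forall>j\<in>{1..m}. snd p j \<in> topspace (Y j)) \<and> (\<forall>j. j \<notin> {1..m} \<longrightarrow> snd p j = 0)}"

definition single :: "nat \<Rightarrow> 'y::zero \<Rightarrow> nat \<Rightarrow> 'y"
  where "single j y = (\<lambda>i. if i = j then y else 0)"

lemma subspace_product_space:
  assumes "\<And>j. j \<in> {1..m} \<Longrightarrow> subspace (topspace (Y j))"
  shows "subspace (product_space m Y)"
  using assms by (auto simp: subspace_def product_space_def)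

lemma single_in_product_space:
  assumes "\<And>j. j \<in> {1..m} \<Longrightarrow> subspace (topspace (Y j))" "j \<in> {1..m}" "y \<in> topspace (Y j)"
  shows "(0, single j y) \<in> product_space m Y"
  using assms by (auto simp: single_def product_space_def subspace_0)

text \<open>
  The coordinates \<open>z j\<close> are switched on one at a time, by induction on the set \<open>J\<close> of those
  that are on. This turns a functional on the product into a family of multipliers.
\<close>

lemma additive_coordinates:
  fixes f :: "real \<times> (nat \<Rightarrow> 'y::real_vector) \<Rightarrow> real"
  assumes Y: "\<And>j. j \<in> {1..m} \<Longrightarrow> subspace (topspace (Y j))"
    and add: "\<And>v w. v \<in> product_space m Y \<Longrightarrow> w \<in> product_space m Y \<Longrightarrow> f (v + w) = f v + f w"
    and scale: "\<And>c v. v \<in> product_space m Y \<Longrightarrow> f (c *\<^sub>R v) = c * f v"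
    and z: "(a, z) \<in> product_space m Y"
  shows "f (a, z) = f (1, 0) * a + (\<Sum>j=1..m. f (0, single j (z j)))"
proof -
  have S: "subspace (product_space m Y)" by (rule subspace_product_space[OF Y])
  have partial: "f (a, \<lambda>i. if i \<in> J then z i else 0) = f (1, 0) * a + (\<Sum>j\<in>J. f (0, single j (z j)))"
    if "finite J" "J \<subseteq> {1..m}" for J
    using that
  proof (induction J)
    case empty
    have one: "(1, 0) \<in> product_space m Y" using Y by (auto simp: product_space_def subspace_0)
    have "(a, \<lambda>i. if i \<in> {} then z i else 0) = a *\<^sub>R (1, 0)" by (auto simp: fun_eq_iff)
    then show ?case using scale[OF one, of a] by (simp only: sum.empty) simp
  next
    case (insert j J)
    have "(a, \<lambda>i. if i \<in> insert j J then z i else 0)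
        = (a, \<lambda>i. if i \<in> J then z i else 0) + (0, single j (z j))"
      using insert.hyps by (auto simp: single_def fun_eq_iff)
    moreover have "(a, \<lambda>i. if i \<in> J then z i else 0) \<in> product_space m Y"
      using z Y by (auto simp: product_space_def subspace_0)
    moreover have "(0, single j (z j)) \<in> product_space m Y"
      using single_in_product_space[of m Y, OF Y] z insert.prems by (auto simp: product_space_def)
    ultimately have "f (a, \<lambda>i. if i \<in> insert j J then z i else 0)
        = f (a, \<lambda>i. if i \<in> J then z i else 0) + f (0, single j (z j))"
      using add by metis
    moreover have "J \<subseteq> {1..m}" using insert.prems by simp
    ultimately show ?case using insert.IH insert.hyps by (simp only: sum.insert ac_simps simp_thms)
  qed
  have "(\<lambda>i. if i \<in> {1..m} then z i else 0) = z"
    using z by (auto simp: product_space_def fun_eq_iff)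
  then show ?thesis using partial[of "{1..m}"] by simp
qed

text \<open>
  The separation of \<open>C\<close> from the open set of all points with negative first and interior
  remaining coordinates. The last equation normalises the multipliers, so they do not all vanish.
\<close>

lemma conic_multipliers:
  fixes Y :: "nat \<Rightarrow> 'y::real_vector topology"
  assumes Y: "\<And>j. j \<in> {1..m} \<Longrightarrow> linear_topological_space (Y j)"
    and KY: "\<And>j. j \<in> {1..m} \<Longrightarrow> K j \<subseteq> topspace (Y j)"
    and K: "\<And>j. j \<in> {1..m} \<Longrightarrow> pos_convex_cone (K j)"
    and C: "real_prod_convex m C" "C \<noteq> {}" "C \<subseteq> topspace (real_prod_topology m Y)"
    and disj: "({..<0} \<times> PiE {1..m} (\<lambda>j. Y j interior_of K j)) \<inter> C = {}"
    and w: "\<And>j. j \<in> {1..m} \<Longrightarrow> w j \<in> Y j interior_of K j"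
  obtains \<tau>\<^sub>0 \<tau> where "\<tau>\<^sub>0 \<ge> 0" "\<And>j. j \<in> {1..m} \<Longrightarrow> \<tau> j \<in> dual_cone (Y j) (K j)"
    "\<And>c. c \<in> C \<Longrightarrow> \<tau>\<^sub>0 * fst c - (\<Sum>j=1..m. \<tau> j (snd c j)) \<ge> 0"
    "\<tau>\<^sub>0 + (\<Sum>j=1..m. \<tau> j (w j)) = 1"
proof -
  have sub: "subspace (topspace (Y j))" if "j \<in> {1..m}" for j
    using Y[OF that] by (simp add: linear_topological_space_def)
  have CY: "snd c j \<in> topspace (Y j)" if "c \<in> C" "j \<in> {1..m}" for c j
    using C(3) that by (fastforce simp: real_prod_topology_def)
  have Cext: "snd c \<in> extensional {1..m}" if "c \<in> C" for c
    using C(3) that by (fastforce simp: real_prod_topology_def PiE_def)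
  have wY: "w j \<in> topspace (Y j)" if "j \<in> {1..m}" for j
    using w[OF that] interior_of_subset_topspace[of "Y j" "K j"] by auto
  let ?S = "product_space m Y"
  have S: "subspace ?S" by (rule subspace_product_space[OF sub])
  \<comment> \<open>The origin is adjoined so that \<open>C\<close> itself lies in the cone \<open>P\<close> below.\<close>
  define M where "M j = insert 0 (K j)" for j
  have M: "convex_cone (M j)" if "j \<in> {1..m}" for j
    unfolding M_def by (rule pos_convex_cone_insert_0[OF K[OF that]])
  have M_add: "x + y \<in> M j" if "j \<in> {1..m}" "x \<in> M j" "y \<in> M j" for x y j
    using convex_cone_add[OF M] that by blast
  \<comment> \<open>The elements of \<open>P\<close> are \<open>r c + (b, - d)\<close> with \<open>b \<ge> 0\<close> and each \<open>d j\<close> in \<open>M j\<close>.\<close>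
  define P where "P = {p \<in> ?S. \<exists>r\<ge>0. \<exists>c\<in>C. r * fst c \<le> fst p \<and>
    (\<forall>j\<in>{1..m}. r *\<^sub>R snd c j - snd p j \<in> M j)}"
  define e where "e = (1::real, \<lambda>j. if j \<in> {1..m} then - w j else 0)"
  obtain c0 where c0: "c0 \<in> C" using C(2) by blast
  have inP0: "p \<in> P" if "p \<in> ?S" "0 \<le> fst p" "\<And>j. j \<in> {1..m} \<Longrightarrow> - snd p j \<in> M j" for p
    unfolding P_def using that c0 by (auto intro!: exI[of _ "0::real"] bexI[of _ c0])
  have eS: "e \<in> ?S"
    using wY sub by (auto simp: e_def product_space_def subspace_neg)
  have eP: "e \<in> P"
  proof (rule inP0[OF eS])
    show "- snd e j \<in> M j" if "j \<in> {1..m}" for j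
      using that w[OF that] interior_of_subset[of "Y j" "K j"] by (auto simp: e_def M_def)
  qed (simp add: e_def)
  have coneP: "convex_cone P"
    unfolding convex_cone_iff
  proof (intro conjI ballI allI impI)
    show "0 \<in> P"
      by (rule inP0) (auto simp: M_def subspace_0[OF S])
    show "p + q \<in> P" if pq: "p \<in> P" "q \<in> P" for p q
    proof -
      obtain r c where rc: "r \<ge> 0" "c \<in> C" "r * fst c \<le> fst p"
        "\<And>j. j \<in> {1..m} \<Longrightarrow> r *\<^sub>R snd c j - snd p j \<in> M j"
        using pq(1) by (auto simp: P_def)
      obtain s d where sd: "s \<ge> 0" "d \<in> C" "s * fst d \<le> fst q"
        "\<And>j. j \<in> {1..m} \<Longrightarrow> s *\<^sub>R snd d j - snd q j \<in> M j"
        using pq(2) by (auto simp: P_def)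
      \<comment> \<open>Convexity of \<open>C\<close> makes its nonnegative multiples closed under addition.\<close>
      have "\<exists>b\<in>C. (r + s) * fst b = r * fst c + s * fst d \<and>
        (\<forall>j\<in>{1..m}. (r + s) *\<^sub>R snd b j = r *\<^sub>R snd c j + s *\<^sub>R snd d j)"
      proof (cases "r + s = 0")
        case True
        then have "r = 0" "s = 0" using rc(1) sd(1) by auto
        then show ?thesis using c0 by (intro bexI[of _ c0]) auto
      next
        case False
        let ?u = "r / (r + s)" and ?v = "s / (r + s)"
        let ?b = "real_prod_add m (real_prod_scale m ?u c) (real_prod_scale m ?v d)"
        have uv: "?u \<ge> 0" "?v \<ge> 0" "?u + ?v = 1"
          using False rc(1) sd(1) by (auto simp flip: add_divide_distrib)
        have "?b \<in> C" using C(1) rc(2) sd(2) uv unfolding real_prod_convex_def by blast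
        moreover have "(r + s) * ?u = r" "(r + s) * ?v = s" using False by auto
        ultimately show ?thesis
          using False by (intro bexI[of _ ?b])
            (auto simp: real_prod_add_def real_prod_scale_def scaleR_add_right distrib_left)
      qed
      then obtain b where b: "b \<in> C" "(r + s) * fst b = r * fst c + s * fst d"
        "\<And>j. j \<in> {1..m} \<Longrightarrow> (r + s) *\<^sub>R snd b j = r *\<^sub>R snd c j + s *\<^sub>R snd d j"
        by blast
      have "(r + s) *\<^sub>R snd b j - snd (p + q) j \<in> M j" if j: "j \<in> {1..m}" for j
      proof -
        have "(r *\<^sub>R snd c j - snd p j) + (s *\<^sub>R snd d j - snd q j) \<in> M j"
          using M_add rc(4) sd(4) j by blast
        then show ?thesis unfolding b(3)[OF j] by (simp add: algebra_simps)
      qed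
      moreover have "p + q \<in> ?S" using pq S by (auto simp: P_def subspace_add)
      moreover have "(r + s) * fst b \<le> fst (p + q)" using b(2) rc(3) sd(3) by simp
      ultimately show ?thesis
        using b(1) rc(1) sd(1) unfolding P_def
        by (intro CollectI conjI exI[of _ "r + s"] bexI[of _ b]) auto
    qed
    show "t *\<^sub>R p \<in> P" if p: "p \<in> P" and t: "0 \<le> t" for p t
    proof -
      obtain r c where rc: "r \<ge> 0" "c \<in> C" "r * fst c \<le> fst p"
        "\<And>j. j \<in> {1..m} \<Longrightarrow> r *\<^sub>R snd c j - snd p j \<in> M j"
        using p by (auto simp: P_def)
      have "(t * r) *\<^sub>R snd c j - snd (t *\<^sub>R p) j \<in> M j" if j: "j \<in> {1..m}" for j
        using convex_cone_scaleR[OF M[OF j] t rc(4)[OF j]] by (simp add: scaleR_diff_right)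
      moreover have "t *\<^sub>R p \<in> ?S" using p S by (auto simp: P_def subspace_scale)
      moreover have "(t * r) * fst c \<le> fst (t *\<^sub>R p)"
        using mult_left_mono[OF rc(3) t] by (simp add: mult.assoc)
      ultimately show ?thesis
        using rc(1,2) t unfolding P_def
        by (intro CollectI conjI exI[of _ "t * r"] bexI[of _ c]) auto
    qed
  qed
  \<comment> \<open>Otherwise \<open>(-1 - b, w + d)\<close> with \<open>b \<ge> 0\<close> and each \<open>d j\<close> in \<open>M j\<close> is a multiple
    of some point of \<open>C\<close>. The factor is positive because \<open>-1 - b < 0\<close>, and then that point
    has a negative first and interior remaining coordinates.\<close>
  have neP: "- e \<notin> P"
  proof
    assume "- e \<in> P"
    then obtain r c where rc: "r \<ge> 0" "c \<in> C" "r * fst c \<le> -1"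
      "\<And>j. j \<in> {1..m} \<Longrightarrow> r *\<^sub>R snd c j - w j \<in> M j"
      by (auto simp: P_def e_def)
    have r: "r > 0" using rc(1,3) by (cases "r = 0") auto
    have "fst c < 0" using rc(3) r by (smt (verit) mult_nonneg_nonneg)
    moreover have "snd c j \<in> Y j interior_of K j" if j: "j \<in> {1..m}" for j
    proof (rule interior_absorbs_cone[OF Y[OF j] KY[OF j] K[OF j] r CY[OF rc(2) j] w[OF j]])
      show "r *\<^sub>R snd c j - w j \<in> insert 0 (K j)" using rc(4)[OF j] by (simp add: M_def)
    qed
    ultimately have "c \<in> {..<0} \<times> PiE {1..m} (\<lambda>j. Y j interior_of K j)"
      using Cext[OF rc(2)] by (cases c) (auto simp: PiE_def)
    then show False using disj rc(2) by blast
  qed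
  have unit: "\<exists>t. v + t *\<^sub>R e \<in> P" if v: "v \<in> ?S" for v
  proof -
    have "\<exists>b. b \<ge> 0 \<and> (\<forall>t\<ge>b. t *\<^sub>R w j - snd v j \<in> K j)" if j: "j \<in> {1..m}" for j
    proof -
      have "snd v j \<in> topspace (Y j)" using v j by (auto simp: product_space_def)
      then show ?thesis using interior_is_order_unit[OF Y[OF j] K[OF j] w[OF j]] by metis
    qed
    then obtain b where b: "\<And>j. j \<in> {1..m} \<Longrightarrow> b j \<ge> 0"
      "\<And>j t. j \<in> {1..m} \<Longrightarrow> t \<ge> b j \<Longrightarrow> t *\<^sub>R w j - snd v j \<in> K j"
      by metis
    define t where "t = \<bar>fst v\<bar> + (\<Sum>j=1..m. b j)"
    have tb: "t \<ge> b j" if j: "j \<in> {1..m}" for j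
      using member_le_sum[of j "{1..m}" b] b(1) j by (force simp: t_def)
    have "(\<Sum>j=1..m. b j) \<ge> 0" using b(1) by (intro sum_nonneg) auto
    then have "0 \<le> fst (v + t *\<^sub>R e)" by (auto simp: e_def t_def)
    moreover have "v + t *\<^sub>R e \<in> ?S" using v eS S by (simp add: subspace_add subspace_scale)
    moreover have "- snd (v + t *\<^sub>R e) j \<in> M j" if j: "j \<in> {1..m}" for j
      using b(2)[OF j tb[OF j]] j by (simp add: e_def M_def)
    ultimately show ?thesis using inP0 by blast
  qed
  have PS: "P \<subseteq> ?S" by (auto simp: P_def)
  obtain Q where Q: "convex_cone Q" "P \<subseteq> Q" "Q \<subseteq> ?S" "- e \<notin> Q"
    "\<And>v. v \<in> ?S \<Longrightarrow> v \<in> Q \<or> - v \<in> Q"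
    using convex_cone_extend_total[OF S coneP PS eP neP] by blast
  obtain f where f: "\<And>v u. v \<in> ?S \<Longrightarrow> u \<in> ?S \<Longrightarrow> f (v + u) = f v + f u"
    "\<And>c v. v \<in> ?S \<Longrightarrow> f (c *\<^sub>R v) = c * f v"
    "\<And>v. v \<in> ?S \<Longrightarrow> v \<in> Q \<Longrightarrow> f v \<ge> 0" "f e = 1"
    using total_convex_cone_functional[of ?S Q e] S Q eP eS unit by blast
  have fP: "f p \<ge> 0" if "p \<in> P" for p using that f(3) Q(2) PS by blast
  define \<tau> where "\<tau> j y = - f (0, single j y)" for j y
  have coord: "f (a, z) = f (1, 0) * a - (\<Sum>j=1..m. \<tau> j (z j))" if "(a, z) \<in> ?S" for a z
    using additive_coordinates[of m Y f, OF sub f(1) f(2) that] by (simp add: \<tau>_def sum_negf)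
  have "(1, 0) \<in> P"
    by (rule inP0) (use sub in \<open>auto simp: product_space_def subspace_0 M_def\<close>)
  then have "f (1, 0) \<ge> 0" by (rule fP)
  moreover have "\<tau> j \<in> dual_cone (Y j) (K j)" if j: "j \<in> {1..m}" for j
  proof -
    have inS: "(0, single j y) \<in> ?S" if "y \<in> topspace (Y j)" for y
      using sub j that by (rule single_in_product_space)
    have add: "\<tau> j (x + y) = \<tau> j x + \<tau> j y"
      if "x \<in> topspace (Y j)" "y \<in> topspace (Y j)" for x y
    proof -
      have "(0, single j (x + y)) = (0, single j x) + (0::real, single j y)"
        by (auto simp: single_def fun_eq_iff)
      then have "f (0, single j (x + y)) = f (0, single j x) + f (0, single j y)"
        using f(1)[OF inS[OF that(1)] inS[OF that(2)]] by (simp only:)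
      then show ?thesis by (simp add: \<tau>_def)
    qed
    have scale: "\<tau> j (c *\<^sub>R x) = c * \<tau> j x" if "x \<in> topspace (Y j)" for x c
    proof -
      have "(0, single j (c *\<^sub>R x)) = c *\<^sub>R (0::real, single j x)"
        by (auto simp: single_def fun_eq_iff)
      then have "f (0, single j (c *\<^sub>R x)) = c * f (0, single j x)"
        using f(2)[OF inS[OF that], of c] by (simp only:)
      then show ?thesis by (simp add: \<tau>_def)
    qed
    have nonneg: "\<tau> j y \<ge> 0" if y: "y \<in> K j" for y
    proof -
      have yT: "y \<in> topspace (Y j)" using y KY[OF j] by blast
      have "(0, single j (- y)) \<in> P"
        by (rule inP0) (use inS sub[OF j] yT y in \<open>auto simp: subspace_neg single_def M_def\<close>)
      then have "\<tau> j ((-1) *\<^sub>R y) \<le> 0" using fP by (simp add: \<tau>_def)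
      then show ?thesis using scale[OF yT, of "-1"] by simp
    qed
    have "continuous_map (Y j) euclideanreal (\<tau> j)"
      using nonneg_on_open_imp_continuous[OF Y[OF j] add scale openin_interior_of w[OF j]]
        nonneg interior_of_subset[of "Y j" "K j"] by blast
    then show ?thesis
      using add scale nonneg by (simp add: dual_cone_def continuous_dual_def)
  qed
  moreover have "f (1, 0) * fst c - (\<Sum>j=1..m. \<tau> j (snd c j)) \<ge> 0" if c: "c \<in> C" for c
  proof -
    let ?z = "\<lambda>j. if j \<in> {1..m} then snd c j else 0"
    have zS: "(fst c, ?z) \<in> ?S" using CY[OF c] by (auto simp: product_space_def)
    moreover have "(fst c, ?z) \<in> P"
      unfolding P_def using zS c by (auto intro!: exI[of _ "1::real"] bexI[of _ c] simp: M_def)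
    ultimately have "0 \<le> f (1, 0) * fst c - (\<Sum>j=1..m. \<tau> j (?z j))" using fP coord by metis
    then show ?thesis by simp
  qed
  moreover have "f (1, 0) + (\<Sum>j=1..m. \<tau> j (w j)) = 1"
  proof -
    have "\<tau> j (- w j) = - \<tau> j (w j)" if j: "j \<in> {1..m}" for j
    proof -
      have "(0, single j (- w j)) = (-1) *\<^sub>R (0::real, single j (w j))"
        by (auto simp: single_def fun_eq_iff)
      then have "f (0, single j (- w j)) = (-1) * f (0, single j (w j))"
        using f(2)[OF single_in_product_space[of m Y, OF sub j wY[OF j]], of "-1"] by (simp only:)
      then show ?thesis by (simp add: \<tau>_def)
    qed
    moreover have "f e = f (1, 0) * 1 - (\<Sum>j=1..m. \<tau> j (if j \<in> {1..m} then - w j else 0))"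
      using coord eS unfolding e_def by blast
    ultimately show ?thesis using f(4) by (simp add: sum_negf)
  qed
  ultimately show thesis using that by blast
qed

section \<open>The S-procedure\<close>

theorem theorem1:
  fixes X :: "'x::real_vector topology"
    and Y :: "nat \<Rightarrow> 'y::real_vector topology"
    and m :: nat
    and F :: "'x \<Rightarrow> real"
    and G :: "nat \<Rightarrow> 'x \<Rightarrow> 'y"
    and K :: "nat \<Rightarrow> 'y set"
  assumes "linear_topological_space X"
    and "\<And>j. j \<in> {1..m} \<Longrightarrow> linear_topological_space (Y j)"
    and "\<And>j. j \<in> {1..m} \<Longrightarrow> continuous_map X (Y j) (G j)"
    and "\<And>j. j \<in> {1..m} \<Longrightarrow> K j \<subseteq> topspace (Y j)"
    and "\<And>j. j \<in> {1..m} \<Longrightarrow> pos_convex_cone (K j)"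
    and "real_prod_convex m
           (real_prod_topology m Y closure_of generated_cone m (joint_image m X F G))"
  shows "((\<forall>x\<in>topspace X. (\<forall>j\<in>{1..m}. G j x \<in> K j) \<longrightarrow> F x \<ge> 0) \<longrightarrow>
            (\<exists>\<tau>\<^sub>0 \<tau>. \<tau>\<^sub>0 \<ge> 0 \<and> (\<forall>j\<in>{1..m}. \<tau> j \<in> dual_cone (Y j) (K j)) \<and>
               (\<forall>x\<in>topspace X. \<tau>\<^sub>0 * F x - (\<Sum>j=1..m. \<tau> j (G j x)) \<ge> 0))) \<and>
         ((\<exists>x\<^sub>0\<in>topspace X. \<forall>j\<in>{1..m}. G j x\<^sub>0 \<in> Y j interior_of K j) \<longrightarrow>
          (\<forall>x\<in>topspace X. (\<forall>j\<in>{1..m}. G j x \<in> K j) \<longrightarrow> F x \<ge> 0) \<longrightarrow>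
            (\<exists>\<tau>. (\<forall>j\<in>{1..m}. \<tau> j \<in> dual_cone (Y j) (K j)) \<and>
               (\<forall>x\<in>topspace X. 1 * F x - (\<Sum>j=1..m. \<tau> j (G j x)) \<ge> 0)))"
proof (intro conjI impI)
  have "(\<lambda>_. 0) \<in> dual_cone (Y j) (K j)" for j
    by (simp add: dual_cone_def continuous_dual_def)
  then show "\<exists>\<tau>\<^sub>0 \<tau>. \<tau>\<^sub>0 \<ge> 0 \<and> (\<forall>j\<in>{1..m}. \<tau> j \<in> dual_cone (Y j) (K j)) \<and>
      (\<forall>x\<in>topspace X. \<tau>\<^sub>0 * F x - (\<Sum>j=1..m. \<tau> j (G j x)) \<ge> 0)"
    by (intro exI[of _ "0::real"] exI[of _ "\<lambda>_ _. 0"]) simp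
next
  assume "\<exists>x\<^sub>0\<in>topspace X. \<forall>j\<in>{1..m}. G j x\<^sub>0 \<in> Y j interior_of K j"
    and A: "\<forall>x\<in>topspace X. (\<forall>j\<in>{1..m}. G j x \<in> K j) \<longrightarrow> F x \<ge> 0"
  then obtain x0 where x0: "x0 \<in> topspace X"
    and reg: "\<And>j. j \<in> {1..m} \<Longrightarrow> G j x0 \<in> Y j interior_of K j" by blast
  define C where "C = real_prod_topology m Y closure_of generated_cone m (joint_image m X F G)"
  define g where "g x = (F x, \<lambda>j\<in>{1..m}. G j x)" for x
  have GY: "G j x \<in> topspace (Y j)" if "x \<in> topspace X" "j \<in> {1..m}" for x j
    using continuous_map_image_subset_topspace[OF assms(3)[OF that(2)]] that(1) by blast
  have cone: "generated_cone m (joint_image m X F G)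
      = {real_prod_scale m r (g x) | r x. r > 0 \<and> x \<in> topspace X}"
    by (auto simp: generated_cone_def joint_image_def g_def)
  have "generated_cone m (joint_image m X F G) \<subseteq> topspace (real_prod_topology m Y)"
    unfolding cone using GY assms(2)
    by (auto simp: real_prod_topology_def real_prod_scale_def g_def
        linear_topological_space_def subspace_scale)
  then have "generated_cone m (joint_image m X F G) \<subseteq> C"
    unfolding C_def by (rule closure_of_subset)
  moreover have "g x \<in> generated_cone m (joint_image m X F G)" if "x \<in> topspace X" for x
    unfolding cone
  proof (intro CollectI exI conjI)
    show "g x = real_prod_scale m 1 (g x)"
      by (auto simp: g_def real_prod_scale_def)
  qed (use that in auto)
  ultimately have gC: "g x \<in> C" if "x \<in> topspace X" for x
    using that by blast
  let ?D = "{..<0::real} \<times> PiE {1..m} (\<lambda>j. Y j interior_of K j)"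
  have "openin (real_prod_topology m Y) ?D"
    unfolding real_prod_topology_def
    by (simp add: openin_prod_Times_iff openin_PiE_gen)
  moreover have "?D \<inter> generated_cone m (joint_image m X F G) = {}"
  proof (rule ccontr)
    assume "?D \<inter> generated_cone m (joint_image m X F G) \<noteq> {}"
    then obtain p where p: "p \<in> ?D" "p \<in> generated_cone m (joint_image m X F G)" by blast
    then obtain r x where r: "r > 0" and x: "x \<in> topspace X" and "p = real_prod_scale m r (g x)"
      unfolding cone by blast
    with p(1) have "fst (real_prod_scale m r (g x)) < 0"
      and D: "\<And>j. j \<in> {1..m} \<Longrightarrow> snd (real_prod_scale m r (g x)) j \<in> Y j interior_of K j"
      by auto
    then have "F x < 0"
      using r by (simp add: g_def real_prod_scale_def mult_less_0_iff)
    moreover have "G j x \<in> K j" if j: "j \<in> {1..m}" for j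
    proof -
      have "r *\<^sub>R G j x \<in> K j"
        using D[OF j] j interior_of_subset[of "Y j" "K j"]
        by (auto simp: g_def real_prod_scale_def)
      then show ?thesis by (simp only: pos_convex_cone_scaleR_iff[OF assms(5)[OF j] r])
    qed
    ultimately show False using A x by force
  qed
  ultimately have disj: "?D \<inter> C = {}"
    unfolding C_def by (simp add: openin_Int_closure_of_eq_empty)
  obtain \<tau>\<^sub>0 \<tau> where \<tau>: "\<tau>\<^sub>0 \<ge> 0" "\<And>j. j \<in> {1..m} \<Longrightarrow> \<tau> j \<in> dual_cone (Y j) (K j)"
    "\<And>c. c \<in> C \<Longrightarrow> \<tau>\<^sub>0 * fst c - (\<Sum>j=1..m. \<tau> j (snd c j)) \<ge> 0"
    "\<tau>\<^sub>0 + (\<Sum>j=1..m. \<tau> j (G j x0)) = 1"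
  proof (rule conic_multipliers[of m Y K C "\<lambda>j. G j x0"])
    show "real_prod_convex m C" using assms(6) by (simp add: C_def)
    show "C \<noteq> {}" using gC x0 by blast
    show "C \<subseteq> topspace (real_prod_topology m Y)"
      unfolding C_def by (rule closure_of_subset_topspace)
  qed (use assms disj reg in auto)
  have ineq: "\<tau>\<^sub>0 * F x - (\<Sum>j=1..m. \<tau> j (G j x)) \<ge> 0" if "x \<in> topspace X" for x
    using \<tau>(3)[OF gC[OF that]] by (simp add: g_def)
  \<comment> \<open>If \<open>\<tau>\<^sub>0 = 0\<close>, then the sum at \<open>x0\<close> would be both \<open>1\<close> and at most \<open>0\<close>.\<close>
  have "\<tau>\<^sub>0 \<noteq> 0"
    using \<tau>(4) ineq[OF x0] by auto
  then have pos: "\<tau>\<^sub>0 > 0" using \<tau>(1) by simp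
  define \<sigma> where "\<sigma> j y = inverse \<tau>\<^sub>0 * \<tau> j y" for j y
  have "\<sigma> j \<in> dual_cone (Y j) (K j)" if j: "j \<in> {1..m}" for j
  proof -
    have "continuous_map (Y j) euclideanreal (\<lambda>y. inverse \<tau>\<^sub>0 * \<tau> j y)"
      using \<tau>(2)[OF j]
      by (intro continuous_map_real_mult) (auto simp: dual_cone_def continuous_dual_def)
    then show ?thesis
      using \<tau>(2)[OF j] pos
      by (auto simp: dual_cone_def continuous_dual_def \<sigma>_def[abs_def] distrib_left)
  qed
  moreover have "1 * F x - (\<Sum>j=1..m. \<sigma> j (G j x)) \<ge> 0" if "x \<in> topspace X" for x
  proof -
    have "0 \<le> inverse \<tau>\<^sub>0 * (\<tau>\<^sub>0 * F x - (\<Sum>j=1..m. \<tau> j (G j x)))"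
      using ineq[OF that] pos by simp
    also have "\<dots> = F x - (\<Sum>j=1..m. \<sigma> j (G j x))"
      using pos by (simp add: \<sigma>_def right_diff_distrib sum_distrib_left flip: mult.assoc)
    finally show ?thesis by simp
  qed
  ultimately show "\<exists>\<tau>. (\<forall>j\<in>{1..m}. \<tau> j \<in> dual_cone (Y j) (K j)) \<and>
      (\<forall>x\<in>topspace X. 1 * F x - (\<Sum>j=1..m. \<tau> j (G j x)) \<ge> 0)"
    by blast
qed

end
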